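(* Let $\mathcal{H}_n$ denote the $n$-dimensional hypercube, let $\mathrm{tw}_n$ denote the treewidth of $\mathcal{H}_n$, and let $N_n := 2^{2n-1} + n2^n$. There exists no family $(C_n)_{n \in \mathbb{N}}$, where each $C_n$ is an XOR-circuit over $\mathcal{H}_n$, such that all of the following hold: (1) there is a polynomial $p$ with $|V_{C_n}| \le p(N_n)$ for all $n$; (2) for every $n$, every automorphism $\pi \in \mathrm{Aut}(\mathcal{H}_n)$ extends to an automorphism of $C_n$ (i.e. the $\mathrm{Aut}(\mathcal{H}_n)$-orbit of $C_n$ under relabelling of input gates has size exactly one); (3) there is a constant $c>0$ such that for all sufficiently large $n$, $C_n$ is sensitive to at least $c\cdot \mathrm{tw}_n$ input gates; (4) there is a constant $K$ such that for all sufficiently large $n$, for any two gates $g,h$ of $C_n$ such that $h$ is a parent of $g$, both $|\mathrm{Orbit}_{(h)}(g)| \le K \log N_n$ and $|\mathrm{Orbit}_{(g)}(h)| \le K\log N_n$.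
   Context: The $n$-dimensional hypercube $\mathcal{H}_n$ is the undirected graph with vertex set $\{0,1\}^n$ in which two strings are adjacent iff their Hamming distance is exactly one; $E(\mathcal{H}_n)$ is its edge set and $\mathrm{Aut}(\mathcal{H}_n)$ its automorphism group, acting on edges via $\{u,v\}\mapsto\{\pi(u),\pi(v)\}$. The number $N_n = 2^{2n-1}+n2^n$ is the number of vertices of a Cai–Fürer–Immerman (CFI) graph over $\mathcal{H}_n$ (each vertex $v$ replaced by $2^{n-1}$ vertices, each edge by $2$ vertices). An XOR-circuit over $\mathcal{H}_n$ is a finite connected directed acyclic graph $C=(V_C,E_C)$ with a unique designated root $r$; a wire $(g,h)\in E_C$ means that the output of $h$ is an input of $g$ ($h$ is a child of $g$, $g$ a parent of $h$). The leaves are input gates and carry an injective labelling $\ell$ from the set of leaves into $E(\mathcal{H}_n)$; every internal gate computes the XOR (sum mod 2) of the values of its children; the output of the circuit is the value of $r$. For an input assignment (one bit per input gate), $C$ is sensitive to an input gate $g$ if flipping the bit of $g$ changes the output value (this does not depend on the assignment). A permutation $\pi\in\mathrm{Aut}(\mathcal{H}_n)$ extends to an automorphism $\sigma$ of $C$ if $\sigma$ is an automorphism of the directed graph $(V_C,E_C)$ with $\ell(\sigma(g))=\pi(\ell(g))$ for every input gate $g$. For gates $g,h$, $\mathrm{Orbit}_{(h)}(g) := \{\sigma(g) \mid \sigma$ an automorphism of $C$ to which some $\pi\in\mathrm{Aut}(\mathcal{H}_n)$ extends, with $\sigma(h)=h\}$, and symmetrically $\mathrm{Orbit}_{(g)}(h)$.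 *)

theory Defs
  imports
    Complex_Main
    "HOL-Combinatorics.Permutations"
    "HOL-Computational_Algebra.Polynomial"
    "Graph_Theory.Graph_Theory"
begin

text \<open>
  Digraphs are pair digraphs; undirected simple graphs are, as usual in \<^theory>\<open>Graph_Theory.Digraph\<close>,
  symmetric loop-free pair digraphs. The name \<open>connected\<close> is qualified because
  it also names the topological notion.
\<close>

definition graph_edges :: "'a pair_pre_digraph \<Rightarrow> 'a set set" where
  "graph_edges G = {{u, v} | u v. (u, v) \<in> parcs G}"

definition Aut :: "'a pair_pre_digraph \<Rightarrow> ('a \<Rightarrow> 'a) set" where
  "Aut G = {\<pi>. \<pi> permutes pverts G \<and>
     (\<forall>u \<in> pverts G. \<forall>v \<in> pverts G. (u, v) \<in> parcs G \<longleftrightarrow> (\<pi> u, \<pi> v) \<in> parcs G)}"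


section \<open>Hypercubes\<close>

definition hamming_dist :: "bool list \<Rightarrow> bool list \<Rightarrow> nat" where
  "hamming_dist u v = card {i. i < length u \<and> u ! i \<noteq> v ! i}"

definition hypercube :: "nat \<Rightarrow> bool list pair_pre_digraph" where
  "hypercube n =
     \<lparr> pverts = {u. length u = n},
       parcs = {(u, v). length u = n \<and> length v = n \<and> hamming_dist u v = 1} \<rparr>"

definition cfi_size :: "nat \<Rightarrow> nat" where
  "cfi_size n = 2 ^ (2 * n - 1) + n * 2 ^ n"


section \<open>Treewidth\<close>

text \<open>
  The predicate \<open>tree\<close> of \<^theory>\<open>Graph_Theory.Digraph_Component\<close> only forbids directed cycles. In a symmetric
  digraph every edge is a directed cycle of length 2, and the cycles of length at least 3 are exactly
  the cycles of the undirected graph.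
\<close>

definition undirected_tree :: "'t pair_pre_digraph \<Rightarrow> bool" where
  "undirected_tree T \<longleftrightarrow>
     pair_graph T \<and>
     Digraph_Component.connected (with_proj T) \<and>
     \<not> (\<exists>p. pre_digraph.cycle (with_proj T) p \<and> length p \<ge> 3)"

definition tree_decomposition ::
    "'a pair_pre_digraph \<Rightarrow> 't pair_pre_digraph \<Rightarrow> ('t \<Rightarrow> 'a set) \<Rightarrow> bool" where
  "tree_decomposition G T bag \<longleftrightarrow>
     undirected_tree T \<and>
     (\<Union>t \<in> pverts T. bag t) = pverts G \<and>
     (\<forall>e \<in> graph_edges G. \<exists>t \<in> pverts T. e \<subseteq> bag t) \<and>
     (\<forall>v \<in> pverts G. Digraph_Component.connected (with_proj T \<restriction> {t \<in> pverts T. v \<in> bag t}))"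

definition decomposition_width :: "'t pair_pre_digraph \<Rightarrow> ('t \<Rightarrow> 'a set) \<Rightarrow> nat" where
  "decomposition_width T bag = Max ((\<lambda>t. card (bag t)) ` pverts T) - 1"

text \<open>The trees are finite, so tree nodes may be taken to be natural numbers.\<close>

definition treewidth :: "'a pair_pre_digraph \<Rightarrow> nat" where
  "treewidth G = (LEAST w. \<exists>(T :: nat pair_pre_digraph) bag.
     tree_decomposition G T bag \<and> decomposition_width T bag = w)"


section \<open>XOR-circuits over hypercubes\<close>

record 'g circuit =
  dag :: "'g pair_pre_digraph"
  root :: 'g
  label :: "'g \<Rightarrow> bool list set"

abbreviation gates :: "'g circuit \<Rightarrow> 'g set" where
  "gates C \<equiv> pverts (dag C)"

text \<open>A wire \<open>(g, h)\<close> leads from the parent \<open>g\<close> to the child \<open>h\<close>.\<close>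

abbreviation wires :: "'g circuit \<Rightarrow> ('g \<times> 'g) set" where
  "wires C \<equiv> parcs (dag C)"

definition input_gates :: "'g circuit \<Rightarrow> 'g set" where
  "input_gates C = {g \<in> gates C. \<forall>h. (g, h) \<notin> wires C}"

text \<open>
  The root is the unique gate without parents. There is no such circuit over the 0-dimensional
  hypercube: a finite nonempty dag has a leaf, and that graph has no edge to label it with.
\<close>

definition xor_circuit :: "nat \<Rightarrow> 'g circuit \<Rightarrow> bool" where
  "xor_circuit n C \<longleftrightarrow>
     pair_fin_digraph (dag C) \<and>
     Digraph_Component.connected (with_proj (dag C)) \<and>
     acyclic (wires C) \<and>
     {g \<in> gates C. \<forall>h. (h, g) \<notin> wires C} = {root C} \<and>
     inj_on (label C) (input_gates C) \<and>
     label C ` input_gates C \<subseteq> graph_edges (hypercube n)"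

definition gate_value :: "'g circuit \<Rightarrow> ('g \<Rightarrow> bool) \<Rightarrow> 'g \<Rightarrow> bool" where
  "gate_value C a = wfrec ((wires C)\<inverse>)
     (\<lambda>val g. if g \<in> input_gates C then a g else odd (card {h. (g, h) \<in> wires C \<and> val h}))"

lemma gate_value_unfold:
  assumes "xor_circuit n C"
  shows "gate_value C a g =
    (if g \<in> input_gates C then a g
     else odd (card {h. (g, h) \<in> wires C \<and> gate_value C a h}))"
proof -
  have "finite (wires C)" and "acyclic (wires C)"
    using assms by (auto simp: xor_circuit_def pair_fin_digraph_def pair_fin_digraph_axioms_def)
  then have "wf ((wires C)\<inverse>)"
    by (simp add: finite_acyclic_wf_converse)
  then show ?thesis
    by (subst def_wfrec[OF gate_value_def[THEN eq_reflection]])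
       (auto simp: cut_def cong: conj_cong)
qed

definition circuit_output :: "'g circuit \<Rightarrow> ('g \<Rightarrow> bool) \<Rightarrow> bool" where
  "circuit_output C a = gate_value C a (root C)"

definition sensitive_to :: "'g circuit \<Rightarrow> 'g \<Rightarrow> bool" where
  "sensitive_to C g \<longleftrightarrow> g \<in> input_gates C \<and>
     (\<forall>a. circuit_output C (a(g := \<not> a g)) \<noteq> circuit_output C a)"

text \<open>A permutation of the vertices acts on an edge by taking its image.\<close>

definition extends_to :: "'g circuit \<Rightarrow> (bool list \<Rightarrow> bool list) \<Rightarrow> ('g \<Rightarrow> 'g) \<Rightarrow> bool" where
  "extends_to C \<pi> \<sigma> \<longleftrightarrow> \<sigma> \<in> Aut (dag C) \<and>
     (\<forall>g \<in> input_gates C. label C (\<sigma> g) = \<pi> ` label C g)"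

text \<open>\<open>orbit_fixing n C h g\<close> is the orbit of \<open>g\<close> under the automorphisms that fix \<open>h\<close>.\<close>

definition orbit_fixing :: "nat \<Rightarrow> 'g circuit \<Rightarrow> 'g \<Rightarrow> 'g \<Rightarrow> 'g set" where
  "orbit_fixing n C h g =
     {\<sigma> g | \<sigma>. (\<exists>\<pi> \<in> Aut (hypercube n). extends_to C \<pi> \<sigma>) \<and> \<sigma> h = h}"

end

theory Submission
  imports
    Defs
    "HOL-Combinatorics.Cycles"
    "HOL-Library.Disjoint_Sets"
    "HOL-Library.Z2"
    "HOL-Number_Theory.Cong"
    "HOL-Real_Asymp.Real_Asymp"
begin

text \<open>
  Take \<open>n = m + 1\<close> with \<open>m = 4 * q\<close> and \<open>q\<close> a power of two. By symmetry the circuit depends on every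
  input as soon as it depends on one, in particular on the edge \<open>e\<close> at the origin in the last
  direction. The cyclic shift of the first \<open>m\<close> coordinates fixes \<open>e\<close> and extends to a circuit
  automorphism \<open>\<sigma>\<close> of 2-power order. As a gate depending on \<open>e\<close> has an odd number of children
  depending on \<open>e\<close>, there is a path from the root to \<open>e\<close> all of whose gates are fixed by \<open>\<sigma>\<close>.

  For a gate \<open>g\<close> let \<open>W g = flip_stabilizer {..<m} g\<close> be the space of translations of the first
  \<open>m\<close> coordinates that extend to an automorphism fixing \<open>g\<close>. It is everything at the root and
  trivial at \<open>e\<close>, and by the orbit bound its cardinality drops by a factor of at most \<open>O(n)\<close> per
  wire, so some \<open>g\<close> on the path has \<open>2 ^ q < card (W g) \<le> 2 ^ (2 * q)\<close>. As \<open>\<sigma>\<close> fixes \<open>g\<close>, this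
  \<open>W g\<close> is a binary cyclic code of 2-power length. It is so small that all its members have period
  \<open>2 * q\<close>, and so large that they separate the coordinates of one period. Hence no nontrivial
  permutation of the coordinates \<open>2 * q, ..., m - 1\<close> preserves \<open>W g\<close>, the orbit of \<open>g\<close> has at least
  \<open>(2 * q)!\<close> elements, and this exceeds every polynomial in \<open>cfi_size n = 2 ^ O(n)\<close>.
\<close>

section \<open>Fibres and iterates of maps\<close>

lemma card_eq_sum_card_fibres:
  assumes "finite S"
  shows "card S = (\<Sum>y\<in>f ` S. card {x \<in> S. f x = y})"
  using sum.image_gen[OF assms, of "\<lambda>_. 1 :: nat" f] by simp

lemma even_card_if_fixpoint_free_involution:
  assumes "\<And>x. x \<in> S \<Longrightarrow> f x \<in> S" and "\<And>x. x \<in> S \<Longrightarrow> f (f x) = x" and "\<And>x. x \<in> S \<Longrightarrow> f x \<noteq> x"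
  shows "even (card S)"
proof -
  have "(\<Sum>x\<in>S. 1 :: bit) = 0"
    using assms by (intro sum_involution_eq_0[where h = f]) auto
  then have "even (of_nat (card S) :: bit)" by simp
  then show ?thesis by (simp only: even_of_nat_iff)
qed

lemma odd_card_imp_fixpoint:
  assumes "finite S" and "odd (card S)" and "f ` S \<subseteq> S"
    and "\<And>x. x \<in> S \<Longrightarrow> (f ^^ (2 ^ a)) x = x"
  shows "\<exists>x\<in>S. f x = x"
  using assms
proof (induction a arbitrary: S)
  case 0
  then have "S \<noteq> {}" by auto
  with 0 show ?case by auto
next
  case (Suc a)
  let ?g = "f ^^ (2 ^ a)"
  let ?F = "{x \<in> S. ?g x = x}"
  have funpow_mem: "(f ^^ i) x \<in> S" if "x \<in> S" for i x
    using that Suc.prems(3) by (induction i) auto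
  have involution: "?g (?g x) = x" if "x \<in> S" for x
    using Suc.prems(4)[OF that] by (simp add: mult_2 funpow_add)
  have "even (card (S - ?F))"
    using funpow_mem involution by (intro even_card_if_fixpoint_free_involution[where f = ?g]) auto
  moreover have "card S = card ?F + card (S - ?F)"
    using card_Int_Diff[OF Suc.prems(1), of ?F] by (simp add: Collect_conj_eq)
  ultimately have "odd (card ?F)"
    using Suc.prems(2) by simp
  moreover have "f ` ?F \<subseteq> ?F"
    using Suc.prems(3) by (auto simp: funpow_swap1[symmetric])
  ultimately have "\<exists>x\<in>?F. f x = x"
    using Suc.prems(1) by (intro Suc.IH) auto
  then show ?case by auto
qed

lemma power_of_two_power_order:
  assumes "f ^^ s = id" and "s > 0"
  obtains r a where "[r = 1] (mod 2 ^ k)" and "(f ^^ r) ^^ (2 ^ a) = id"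
proof -
  obtain a b where s_eq: "s = 2 ^ a * b" and "odd b"
    using assms(2) by (metis multiplicity_decompose' two_is_prime_nat not_prime_unit gr_implies_not0)
  then have "coprime b (2 ^ k)" by simp
  then obtain r where r_cong: "[r = 0] (mod b)" "[r = 1] (mod 2 ^ k)"
    using binary_chinese_remainder_nat by blast
  from r_cong(1) have "b dvd r" by (simp add: cong_0_iff)
  then obtain c where "r = b * c" ..
  then have "(f ^^ r) ^^ (2 ^ a) = (f ^^ s) ^^ c" by (simp add: s_eq funpow_mult ac_simps)
  then have "(f ^^ r) ^^ (2 ^ a) = id" by (simp add: assms(1))
  with r_cong(2) show ?thesis by (rule that)
qed

lemma funpow_cong_eq:
  assumes "f ^^ s = id" and "[i = j] (mod s)"
  shows "f ^^ i = f ^^ j"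
proof
  fix x
  have "(f ^^ s) x = x" by (simp add: assms(1))
  then show "(f ^^ i) x = (f ^^ j) x"
    using assms(2) funpow_mod_eq[of s f x i] funpow_mod_eq[of s f x j] by (simp add: Cong.cong_def)
qed

lemma funpow_gcd_fixpoint:
  assumes "(f ^^ a) x = x" and "(f ^^ b) x = x"
  shows "(f ^^ gcd a b) x = x"
  using assms
proof (induction a b rule: gcd_nat_induct)
  case (step a b)
  then have "(f ^^ (a mod b)) x = x" by (simp add: funpow_mod_eq)
  with step show ?case by (simp add: gcd_red_nat[of a b])
qed simp

lemma funpow_dvd_fixpoint:
  assumes "(f ^^ a) x = x" and "a dvd b"
  shows "(f ^^ b) x = x"
  using funpow_mod_eq[OF assms(1), of b] assms(2) by simp


section \<open>Binary spaces invariant under a map\<close>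

text \<open>
  Under symmetric difference, sets form a vector space over the field with two elements on which
  \<open>f\<close> acts linearly by preimage, and \<open>vimage_diff f\<close> is the difference of this action and the
  identity.
\<close>

definition vimage_diff :: "('a \<Rightarrow> 'a) \<Rightarrow> 'a set \<Rightarrow> 'a set" where
  "vimage_diff f A = sym_diff (f -` A) A"

lemma vimage_diff_empty [simp]: "vimage_diff f {} = {}"
  by (simp add: vimage_diff_def)

lemma vimage_diff_sym_diff:
  "vimage_diff f (sym_diff A B) = sym_diff (vimage_diff f A) (vimage_diff f B)"
  by (auto simp: vimage_diff_def)

lemma vimage_diff_eq_empty_iff: "vimage_diff f A = {} \<longleftrightarrow> f -` A = A"
  by (auto simp: vimage_diff_def)

lemma funpow_vimage: "((-`) f ^^ t) A = (f ^^ t) -` A" for f :: "'a \<Rightarrow> 'a"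
proof (induction t)
  case (Suc t)
  then have "((-`) f ^^ Suc t) A = f -` (f ^^ t) -` A" by simp
  also have "\<dots> = (f ^^ Suc t) -` A" by (simp only: vimage_comp funpow_Suc_right)
  finally show ?case .
qed simp

lemmas vimage_funpow_gcd = funpow_gcd_fixpoint[where f = "(-`) f" for f, unfolded funpow_vimage]

lemmas vimage_funpow_dvd = funpow_dvd_fixpoint[where f = "(-`) f" for f, unfolded funpow_vimage]

text \<open>The Frobenius identity \<open>(x - 1)^(2^j) = x^(2^j) - 1\<close> in characteristic two.\<close>

lemma funpow_two_power_vimage_diff: "vimage_diff f ^^ (2 ^ j) = vimage_diff (f ^^ (2 ^ j))"
proof (induction j)
  case (Suc j)
  have "vimage_diff g \<circ> vimage_diff g = vimage_diff (g \<circ> g)" for g :: "'a \<Rightarrow> 'a"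
    by (auto simp: vimage_diff_def fun_eq_iff)
  with Suc show ?case by (simp add: mult_2 funpow_add del: comp_apply)
qed simp

locale invariant_binary_space =
  fixes f :: "'a \<Rightarrow> 'a" and W :: "'a set set"
  assumes finite_space: "finite W"
    and empty_mem: "{} \<in> W"
    and sym_diff_mem: "\<lbrakk>A \<in> W; B \<in> W\<rbrakk> \<Longrightarrow> sym_diff A B \<in> W"
    and vimage_mem: "A \<in> W \<Longrightarrow> f -` A \<in> W"
begin

lemma vimage_diff_mem: "A \<in> W \<Longrightarrow> vimage_diff f A \<in> W"
  by (simp add: vimage_diff_def sym_diff_mem vimage_mem)

lemma funpow_vimage_mem: "A \<in> W \<Longrightarrow> (f ^^ t) -` A \<in> W"
  unfolding funpow_vimage[symmetric] by (induction t) (simp_all add: vimage_mem)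

lemma invariant_image_vimage_diff: "invariant_binary_space f (vimage_diff f ` W)"
proof
  show "finite (vimage_diff f ` W)" using finite_space by simp
  show "{} \<in> vimage_diff f ` W" using empty_mem by force
next
  fix A B
  assume "A \<in> vimage_diff f ` W" "B \<in> vimage_diff f ` W"
  then show "sym_diff A B \<in> vimage_diff f ` W"
    by (auto simp only: vimage_diff_sym_diff[symmetric] intro!: imageI sym_diff_mem)
next
  fix A
  assume "A \<in> vimage_diff f ` W"
  then obtain A' where "A' \<in> W" "A = vimage_diff f A'" by blast
  moreover have "f -` vimage_diff f A' = vimage_diff f (f -` A')"
    by (auto simp: vimage_diff_def)
  ultimately show "f -` A \<in> vimage_diff f ` W"
    using vimage_mem by blast
qed

lemma nonzero_kernel:
  assumes "(vimage_diff f ^^ t) A = {}" and "A \<in> W" and "A \<noteq> {}"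
  obtains B where "B \<in> W" and "B \<noteq> {}" and "vimage_diff f B = {}"
  using assms
proof (induction t arbitrary: A)
  case (Suc t)
  show ?case
  proof (cases "vimage_diff f A = {}")
    case False
    moreover have "(vimage_diff f ^^ t) (vimage_diff f A) = {}"
      using Suc.prems(2) by (simp add: funpow_swap1)
    ultimately show ?thesis using Suc vimage_diff_mem by blast
  qed (use Suc.prems in blast)
qed simp

lemma card_image_vimage_diff:
  assumes "B \<in> W" and "B \<noteq> {}" and "vimage_diff f B = {}"
  shows "2 * card (vimage_diff f ` W) \<le> card W"
proof -
  let ?D = "vimage_diff f"
  have "2 \<le> card {A \<in> W. ?D A = Y}" if "Y \<in> ?D ` W" for Y
  proof -
    obtain A where preimage: "A \<in> W" "?D A = Y" using \<open>Y \<in> ?D ` W\<close> by blast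
    have "?D (sym_diff A B) = Y"
      using assms(3) preimage(2) by (simp only: vimage_diff_sym_diff) simp
    then have "{A, sym_diff A B} \<subseteq> {A \<in> W. ?D A = Y}"
      using preimage assms(1) sym_diff_mem by blast
    moreover have "card {A, sym_diff A B} = 2"
      using assms(2) by (subst card_2_iff) blast
    ultimately show ?thesis
      using finite_space card_mono[of "{A \<in> W. ?D A = Y}" "{A, sym_diff A B}"] by simp
  qed
  then have "(\<Sum>Y\<in>?D ` W. 2) \<le> (\<Sum>Y\<in>?D ` W. card {A \<in> W. ?D A = Y})"
    by (rule sum_mono)
  also have "\<dots> = card W"
    by (rule card_eq_sum_card_fibres[OF finite_space, symmetric])
  finally show ?thesis by simp
qed

end

lemma funpow_vimage_diff_eq_empty:
  assumes "invariant_binary_space f W" and "f ^^ (2 ^ k) = id" and "card W \<le> 2 ^ d" and "A \<in> W"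
  shows "(vimage_diff f ^^ d) A = {}"
  using assms
proof (induction d arbitrary: W A)
  case 0
  then interpret invariant_binary_space f W by simp
  have "card W \<le> Suc 0" using 0 by simp
  then show ?case
    using finite_space empty_mem 0 by (auto simp: card_le_Suc0_iff_eq)
next
  case (Suc d)
  then interpret invariant_binary_space f W by simp
  have "card (vimage_diff f ` W) \<le> 2 ^ d"
  proof (cases "W = {{}}")
    case False
    then obtain A where "A \<in> W" "A \<noteq> {}" using empty_mem by blast
    moreover have "(vimage_diff f ^^ (2 ^ k)) A = {}"
      by (simp add: funpow_two_power_vimage_diff Suc.prems(2) vimage_diff_eq_empty_iff)
    ultimately obtain B where "B \<in> W" "B \<noteq> {}" "vimage_diff f B = {}"
      using nonzero_kernel by blast
    then show ?thesis using card_image_vimage_diff[of B] Suc.prems(3) by simp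
  qed simp
  then have "(vimage_diff f ^^ d) (vimage_diff f A) = {}"
    using Suc.prems by (intro Suc.IH[OF invariant_image_vimage_diff]) auto
  then show ?case by (simp add: funpow_swap1)
qed

lemma (in invariant_binary_space) vimage_funpow_eq_if_card_le:
  assumes "f ^^ (2 ^ k) = id" and "card W \<le> 2 ^ (2 ^ j)" and "A \<in> W"
  shows "(f ^^ (2 ^ j)) -` A = A"
  using funpow_vimage_diff_eq_empty[OF invariant_binary_space_axioms assms]
  by (simp add: funpow_two_power_vimage_diff vimage_diff_eq_empty_iff)


section \<open>Binary cyclic codes of 2-power length\<close>

abbreviation cyclic_shift :: "nat \<Rightarrow> nat \<Rightarrow> nat" where
  "cyclic_shift m \<equiv> cycle_of_list [0..<m]"

lemma cyclic_shift_permutes: "cyclic_shift m permutes {..<m}"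
  using cycle_permutes[of "[0..<m]"] by (simp add: atLeast0LessThan)

lemma funpow_cyclic_shift_self: "cyclic_shift m ^^ m = id"
  using cycle_is_id_root[of "[0..<m]"] by simp

lemma funpow_cyclic_shift: "i < m \<Longrightarrow> (cyclic_shift m ^^ t) i = (t + i) mod m"
  using arg_cong[OF cyclic_rotation[of "[0..<m]" t], of "\<lambda>xs. xs ! i"]
  by (simp add: nth_rotate)

locale cyclic_code = invariant_binary_space "cyclic_shift m" W for m W +
  assumes subset_Pow: "W \<subseteq> Pow {..<m}"
begin

lemma vimage_shift_eq_if_unseparated:
  assumes "a < m" and "\<And>A. A \<in> W \<Longrightarrow> a \<in> A \<longleftrightarrow> (d + a) mod m \<in> A" and "A \<in> W"
  shows "(cyclic_shift m ^^ d) -` A = A"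
proof -
  let ?s = "cyclic_shift m"
  have "(?s ^^ d) i \<in> A \<longleftrightarrow> i \<in> A" if "i < m" for i
  proof -
    let ?t = "m - a + i"
    have shift_a: "(?s ^^ ?t) a = i" using assms(1) that by (simp add: funpow_cyclic_shift)
    have "i \<in> A \<longleftrightarrow> a \<in> (?s ^^ ?t) -` A" by (simp add: shift_a)
    also have "\<dots> \<longleftrightarrow> (?s ^^ d) a \<in> (?s ^^ ?t) -` A"
      unfolding funpow_cyclic_shift[OF assms(1)] by (intro assms(2) funpow_vimage_mem assms(3))
    also have "(?s ^^ ?t) ((?s ^^ d) a) = (?s ^^ d) i"
      by (metis add.commute comp_apply funpow_add shift_a)
    then have "(?s ^^ d) a \<in> (?s ^^ ?t) -` A \<longleftrightarrow> (?s ^^ d) i \<in> A" by simp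
    finally show ?thesis ..
  qed
  moreover have "A \<subseteq> {..<m}" using subset_Pow assms(3) by blast
  moreover have "(?s ^^ d) i < m \<longleftrightarrow> i < m" for i
    using permutes_in_image[OF permutes_funpow[OF cyclic_shift_permutes], of d m i] by simp
  ultimately show ?thesis by blast
qed

lemma card_le_if_periodic:
  assumes "p > 0" and periodic: "\<And>A. A \<in> W \<Longrightarrow> (cyclic_shift m ^^ p) -` A = A"
  shows "card W \<le> 2 ^ p"
proof -
  have mod_mem_iff: "i mod p \<in> A \<longleftrightarrow> i \<in> A" if "A \<in> W" "i < m" for A i
  proof -
    have "(cyclic_shift m ^^ (p * (i div p))) -` A = A"
      using periodic[OF that(1)] by (rule vimage_funpow_dvd) simp
    moreover have "(cyclic_shift m ^^ (p * (i div p))) (i mod p) = i"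
      using that(2) le_less_trans[OF mod_less_eq_dividend[of i p]] by (simp add: funpow_cyclic_shift)
    ultimately show ?thesis by (metis vimage_eq)
  qed
  have "inj_on (\<lambda>A. A \<inter> {..<p}) W"
  proof (rule inj_onI)
    fix A B
    assume A_mem: "A \<in> W" and B_mem: "B \<in> W" and restrictions_eq: "A \<inter> {..<p} = B \<inter> {..<p}"
    have "i \<in> A \<longleftrightarrow> i \<in> B" if "i < m" for i
    proof -
      have "i mod p \<in> A \<longleftrightarrow> i mod p \<in> B"
        using restrictions_eq mod_less_divisor[OF assms(1), of i] by blast
      then show ?thesis using mod_mem_iff[OF A_mem that] mod_mem_iff[OF B_mem that] by simp
    qed
    moreover have "A \<subseteq> {..<m}" "B \<subseteq> {..<m}" using A_mem B_mem subset_Pow by auto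
    ultimately show "A = B" by blast
  qed
  then have "card W \<le> card (Pow {..<p})" by (rule card_inj_on_le) auto
  then show ?thesis by (simp add: card_Pow)
qed

lemma separates_coordinates:
  assumes length: "m = 2 ^ k" and large: "2 ^ (2 ^ j) < card W"
    and coordinates: "a < b" "b < m" "b - a < 2 ^ Suc j"
  shows "\<exists>A\<in>W. \<not> (a \<in> A \<longleftrightarrow> b \<in> A)"
proof (rule ccontr)
  assume "\<not> ?thesis"
  then have unseparated: "a \<in> A \<longleftrightarrow> (b - a + a) mod m \<in> A" if "A \<in> W" for A
    using that coordinates by auto
  obtain i where gcd_power: "gcd (b - a) m = 2 ^ i"
    using divides_primepow_nat[OF two_is_prime_nat, of "gcd (b - a) m" k] length by auto
  have "gcd (b - a) m \<le> b - a" using coordinates(1) by simp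
  then have "(2::nat) ^ i < 2 ^ Suc j" using gcd_power coordinates(3) by simp
  then have "i \<le> j" by (simp only: power_strict_increasing_iff less_Suc_eq_le)
  then have dvd: "gcd (b - a) m dvd 2 ^ j" by (simp add: gcd_power le_imp_power_dvd)
  have "(cyclic_shift m ^^ (2 ^ j)) -` A = A" if "A \<in> W" for A
  proof -
    have "(cyclic_shift m ^^ (b - a)) -` A = A"
      using coordinates that unseparated by (intro vimage_shift_eq_if_unseparated[of a]) auto
    moreover have "(cyclic_shift m ^^ m) -` A = A" by (simp add: funpow_cyclic_shift_self)
    ultimately have "(cyclic_shift m ^^ gcd (b - a) m) -` A = A" by (rule vimage_funpow_gcd)
    then show ?thesis using dvd by (rule vimage_funpow_dvd)
  qed
  then have "card W \<le> 2 ^ (2 ^ j)" by (intro card_le_if_periodic) auto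
  then show False using large by simp
qed

text \<open>
  In the given range of cardinalities, the coordinates on which all members of \<open>W\<close> agree are
  exactly the pairs \<open>{i, i + 2 * q}\<close>, and a permutation of the upper half breaks this matching.
\<close>

lemma upper_half_stabilizer_trivial:
  assumes length: "m = 4 * q" and q_power: "q = 2 ^ k"
    and card: "2 ^ q < card W" "card W \<le> 2 ^ (2 * q)"
    and perm: "\<rho> permutes {2 * q..<m}" and invariant: "\<And>A. A \<in> W \<Longrightarrow> \<rho> -` A \<in> W"
  shows "\<rho> = id"
proof -
  have length_power: "m = 2 ^ (k + 2)" and double_q: "2 * q = 2 ^ Suc k"
    using length q_power by simp_all
  have partner_mem_iff: "i + 2 * q \<in> A \<longleftrightarrow> i \<in> A" if "A \<in> W" "i < 2 * q" for A i
  proof -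
    have "(cyclic_shift m ^^ (2 * q)) -` A = A"
      unfolding double_q using funpow_cyclic_shift_self[of m] card(2) that(1)
      by (intro vimage_funpow_eq_if_card_le[of "k + 2"]) (simp_all only: length_power double_q)
    moreover have "(cyclic_shift m ^^ (2 * q)) i = i + 2 * q"
      using that(2) length by (subst funpow_cyclic_shift) auto
    ultimately show ?thesis by (metis vimage_eq)
  qed
  have "\<rho> b = b" if b_upper: "b \<in> {2 * q..<m}" for b
  proof (rule ccontr)
    assume "\<rho> b \<noteq> b"
    define i where "i = b - 2 * q"
    have b_partner: "b = i + 2 * q" "i < 2 * q" using b_upper length by (auto simp: i_def)
    have "\<rho> i = i" using perm b_partner(2) by (intro permutes_not_in) auto
    then have unseparated: "\<rho> b \<in> A \<longleftrightarrow> b \<in> A" if "A \<in> W" for A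
      using partner_mem_iff[OF that b_partner(2)] partner_mem_iff[OF invariant[OF that] b_partner(2)]
      by (simp add: b_partner(1))
    have "\<rho> b \<in> {2 * q..<m}" using permutes_in_image[OF perm] b_upper by simp
    then have "\<exists>A\<in>W. \<not> (min b (\<rho> b) \<in> A \<longleftrightarrow> max b (\<rho> b) \<in> A)"
      using b_upper \<open>\<rho> b \<noteq> b\<close> length card(1) double_q
      by (intro separates_coordinates[OF length_power, of k]) (auto simp: q_power)
    then show False using unseparated by (auto simp: min_def max_def split: if_splits)
  qed
  then show ?thesis
    using perm by (metis eq_id_iff permutes_not_in)
qed

end


section \<open>Automorphisms of the hypercube\<close>

lemma Aut_permutes: "\<pi> \<in> Aut G \<Longrightarrow> \<pi> permutes pverts G"
  by (simp add: Aut_def)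

lemma Aut_bij: "\<pi> \<in> Aut G \<Longrightarrow> bij \<pi>"
  by (rule permutes_bij[OF Aut_permutes])

lemma Aut_id: "id \<in> Aut G"
  by (simp add: Aut_def)

lemma Aut_comp:
  assumes "\<pi> \<in> Aut G" and "\<pi>' \<in> Aut G"
  shows "\<pi> \<circ> \<pi>' \<in> Aut G"
proof -
  have "\<pi>' u \<in> pverts G" if "u \<in> pverts G" for u
    using permutes_in_image[OF Aut_permutes[OF assms(2)]] that by blast
  then show ?thesis
    using assms permutes_compose[OF Aut_permutes[OF assms(2)] Aut_permutes[OF assms(1)]]
    by (simp add: Aut_def)
qed

lemma Aut_inv:
  assumes "\<pi> \<in> Aut G"
  shows "inv \<pi> \<in> Aut G"
proof -
  note perm = Aut_permutes[OF assms]
  have "(u, v) \<in> parcs G \<longleftrightarrow> (inv \<pi> u, inv \<pi> v) \<in> parcs G" if "u \<in> pverts G" "v \<in> pverts G" for u v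
  proof -
    have "inv \<pi> u \<in> pverts G" "inv \<pi> v \<in> pverts G"
      using permutes_in_image[OF permutes_inv[OF perm]] that by auto
    then have "(inv \<pi> u, inv \<pi> v) \<in> parcs G \<longleftrightarrow> (\<pi> (inv \<pi> u), \<pi> (inv \<pi> v)) \<in> parcs G"
      using assms by (simp add: Aut_def)
    then show ?thesis by (simp add: permutes_inverses[OF perm])
  qed
  then show ?thesis using permutes_inv[OF perm] by (simp add: Aut_def)
qed

lemma (in pair_wf_digraph) Aut_arc_iff:
  assumes "\<pi> \<in> Aut G"
  shows "(\<pi> u, \<pi> v) \<in> parcs G \<longleftrightarrow> (u, v) \<in> parcs G"
proof (cases "u \<in> pverts G \<and> v \<in> pverts G")
  case True
  then show ?thesis using assms by (simp add: Aut_def)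
next
  case False
  then show ?thesis
    using permutes_in_image[OF Aut_permutes[OF assms]] in_arcsD1 in_arcsD2 by blast
qed

definition flip_bits :: "nat \<Rightarrow> nat set \<Rightarrow> bool list \<Rightarrow> bool list" where
  "flip_bits n A u = (if length u = n then map (\<lambda>i. u ! i \<noteq> (i \<in> A)) [0..<n] else u)"

definition permute_bits :: "nat \<Rightarrow> (nat \<Rightarrow> nat) \<Rightarrow> bool list \<Rightarrow> bool list" where
  "permute_bits n \<rho> u = (if length u = n then map (\<lambda>i. u ! \<rho> i) [0..<n] else u)"

lemma length_flip_bits [simp]: "length (flip_bits n A u) = length u"
  by (simp add: flip_bits_def)

lemma length_permute_bits [simp]: "length (permute_bits n \<rho> u) = length u"
  by (simp add: permute_bits_def)

lemma nth_flip_bits [simp]: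
  "\<lbrakk>length u = n; i < n\<rbrakk> \<Longrightarrow> flip_bits n A u ! i \<longleftrightarrow> u ! i \<noteq> (i \<in> A)"
  by (simp add: flip_bits_def)

lemma nth_permute_bits [simp]:
  "\<lbrakk>length u = n; i < n\<rbrakk> \<Longrightarrow> permute_bits n \<rho> u ! i \<longleftrightarrow> u ! \<rho> i"
  by (simp add: permute_bits_def)

lemma flip_bits_other_length [simp]: "length u \<noteq> n \<Longrightarrow> flip_bits n A u = u"
  by (simp add: flip_bits_def)

lemma permute_bits_other_length [simp]: "length u \<noteq> n \<Longrightarrow> permute_bits n \<rho> u = u"
  by (simp add: permute_bits_def)

lemma bit_string_map_eqI:
  fixes f g :: "'a list \<Rightarrow> 'a list"
  assumes "\<And>u. length (f u) = length u" and "\<And>u. length (g u) = length u"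
    and "\<And>u. length u \<noteq> n \<Longrightarrow> f u = g u"
    and "\<And>u i. \<lbrakk>length u = n; i < n\<rbrakk> \<Longrightarrow> f u ! i = g u ! i"
  shows "f = g"
proof
  fix u
  show "f u = g u"
    using assms by (cases "length u = n") (auto intro: nth_equalityI)
qed

lemma flip_bits_comp: "flip_bits n A \<circ> flip_bits n B = flip_bits n (sym_diff A B)"
  by (rule bit_string_map_eqI[where n = n]) auto

lemma flip_bits_empty: "flip_bits n {} = id"
  by (rule bit_string_map_eqI[where n = n]) auto

lemma inv_flip_bits: "inv (flip_bits n A) = flip_bits n A"
  using flip_bits_comp[of n A A] by (intro inv_unique_comp) (simp_all add: flip_bits_empty)

lemma flip_bits_eq_iff:
  assumes "length u = n" and "A \<subseteq> {..<n}" and "B \<subseteq> {..<n}"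
  shows "flip_bits n A u = flip_bits n B u \<longleftrightarrow> A = B"
proof
  assume flips_eq: "flip_bits n A u = flip_bits n B u"
  have "i \<in> A \<longleftrightarrow> i \<in> B" if "i < n" for i
    using arg_cong[OF flips_eq, of "\<lambda>v. v ! i"] assms(1) that by auto
  then show "A = B" using assms(2,3) by blast
qed simp

lemma permute_bits_id: "permute_bits n id = id"
  by (rule bit_string_map_eqI[where n = n]) auto

context
  fixes n :: nat and \<rho> :: "nat \<Rightarrow> nat"
  assumes perm: "\<rho> permutes {..<n}"
begin

lemma permuted_index_less_iff: "\<rho> i < n \<longleftrightarrow> i < n"
  using permutes_in_image[OF perm, of i] by simp

lemma permute_bits_comp: "permute_bits n \<rho> \<circ> permute_bits n \<rho>' = permute_bits n (\<rho>' \<circ> \<rho>)"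
  by (rule bit_string_map_eqI[where n = n]) (auto simp: permuted_index_less_iff)

lemma permute_bits_flip_bits:
  "permute_bits n \<rho> \<circ> flip_bits n A = flip_bits n (\<rho> -` A) \<circ> permute_bits n \<rho>"
  by (rule bit_string_map_eqI[where n = n]) (auto simp: permuted_index_less_iff)

lemma funpow_permute_bits: "permute_bits n \<rho> ^^ t = permute_bits n (\<rho> ^^ t)"
proof (induction t)
  case (Suc t)
  then have "permute_bits n \<rho> ^^ Suc t = permute_bits n (\<rho> ^^ t \<circ> \<rho>)"
    by (simp add: permute_bits_comp)
  then show ?case by (simp only: funpow_Suc_right)
qed (simp add: permute_bits_id[unfolded id_def] id_def)

end

lemma inv_permute_bits:
  assumes "\<rho> permutes {..<n}"
  shows "inv (permute_bits n \<rho>) = permute_bits n (inv \<rho>)"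
  using permute_bits_comp[OF assms] permute_bits_comp[OF permutes_inv[OF assms]]
  by (intro inv_unique_comp) (simp_all add: permutes_inv_o[OF assms] permute_bits_id)

lemma Aut_hypercubeI:
  assumes "bij \<pi>" and "\<And>u. length u \<noteq> n \<Longrightarrow> \<pi> u = u"
    and "\<And>u v. \<lbrakk>length u = n; length v = n\<rbrakk> \<Longrightarrow> hamming_dist (\<pi> u) (\<pi> v) = hamming_dist u v"
  shows "\<pi> \<in> Aut (hypercube n)"
proof -
  have "\<exists>!u. \<pi> u = v" for v using assms(1) by (auto simp: bij_iff)
  then have perm: "\<pi> permutes {u. length u = n}" using assms(2) by (auto simp: permutes_def)
  then have "length (\<pi> u) = n" if "length u = n" for u
    using permutes_in_image[OF perm, of u] that by simp
  then show ?thesis using perm assms(3) by (auto simp: Aut_def hypercube_def)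
qed

lemma flip_bits_Aut: "flip_bits n A \<in> Aut (hypercube n)"
proof (rule Aut_hypercubeI)
  have "flip_bits n A \<circ> flip_bits n A = id" by (simp add: flip_bits_comp flip_bits_empty)
  then show "bij (flip_bits n A)" using o_bij by blast
qed (auto simp: hamming_dist_def intro!: arg_cong[where f = card])

lemma permute_bits_Aut:
  assumes perm: "\<rho> permutes {..<n}"
  shows "permute_bits n \<rho> \<in> Aut (hypercube n)"
proof (rule Aut_hypercubeI)
  show "bij (permute_bits n \<rho>)"
    using permute_bits_comp[OF perm] permute_bits_comp[OF permutes_inv[OF perm]]
    by (intro o_bij[of "permute_bits n (inv \<rho>)"])
      (simp_all add: permutes_inv_o[OF perm] permute_bits_id)
next
  fix u v :: "bool list"
  assume lengths: "length u = n" "length v = n"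
  let ?D = "{i. i < length u \<and> u ! i \<noteq> v ! i}"
  have "{i. i < n \<and> permute_bits n \<rho> u ! i \<noteq> permute_bits n \<rho> v ! i} = \<rho> -` ?D"
    using lengths by (auto simp: permuted_index_less_iff[OF perm])
  moreover have "card (\<rho> -` ?D) = card ?D"
    using permutes_bij[OF perm] by (intro card_vimage_inj) (auto simp: bij_def)
  ultimately show "hamming_dist (permute_bits n \<rho> u) (permute_bits n \<rho> v) = hamming_dist u v"
    using lengths by (simp add: hamming_dist_def)
qed simp

lemma hamming_dist_flip_bits:
  assumes "length u = n" and "A \<subseteq> {..<n}"
  shows "hamming_dist u (flip_bits n A u) = card A"
proof -
  have "{i. i < n \<and> u ! i \<noteq> flip_bits n A u ! i} = A" using assms by auto
  then show ?thesis using assms(1) by (simp add: hamming_dist_def)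
qed

lemma parcs_hypercube_iff:
  "(u, v) \<in> parcs (hypercube n) \<longleftrightarrow> length u = n \<and> (\<exists>i<n. v = flip_bits n {i} u)"
proof
  assume "(u, v) \<in> parcs (hypercube n)"
  then have lengths: "length u = n" "length v = n" and "hamming_dist u v = 1"
    by (auto simp: hypercube_def)
  then obtain i where differing: "{l. l < n \<and> u ! l \<noteq> v ! l} = {i}"
    by (auto simp: hamming_dist_def card_1_singleton_iff)
  then have "v = flip_bits n {i} u" using lengths by (intro nth_equalityI) auto
  moreover have "i < n" using differing by blast
  ultimately show "length u = n \<and> (\<exists>i<n. v = flip_bits n {i} u)" using lengths by blast
qed (auto simp: hypercube_def hamming_dist_flip_bits)

definition axis_edge :: "nat \<Rightarrow> nat \<Rightarrow> bool list set" where
  "axis_edge n i = {replicate n False, flip_bits n {i} (replicate n False)}"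

lemma permute_bits_replicate:
  assumes "\<rho> permutes {..<n}"
  shows "permute_bits n \<rho> (replicate n b) = replicate n b"
  by (rule nth_equalityI) (auto simp: permuted_index_less_iff[OF assms])

lemma permute_bits_axis_edge:
  assumes "\<rho> permutes {..<n}"
  shows "permute_bits n \<rho> ` axis_edge n i = axis_edge n (inv \<rho> i)"
proof -
  let ?z = "replicate n False"
  have "permute_bits n \<rho> (flip_bits n {i} ?z) = flip_bits n (\<rho> -` {i}) (permute_bits n \<rho> ?z)"
    using permute_bits_flip_bits[OF assms] by (metis comp_apply)
  also have "\<rho> -` {i} = {inv \<rho> i}"
    using permutes_bij[OF assms] by (rule bij_vimage_eq_inv_image[THEN trans]) simp
  finally show ?thesis
    by (simp add: axis_edge_def permute_bits_replicate[OF assms])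
qed

lemma hypercube_edge_transitive:
  assumes "e \<in> graph_edges (hypercube n)" and "i < n"
  obtains \<pi> where "\<pi> \<in> Aut (hypercube n)" and "\<pi> ` e = axis_edge n i"
proof -
  obtain u j where length_u: "length u = n" and j_less: "j < n" and e_eq: "e = {u, flip_bits n {j} u}"
    using assms(1) by (auto simp: graph_edges_def parcs_hypercube_iff)
  let ?A = "{l. u ! l}"
  let ?\<rho> = "transpose i j"
  have transposition: "?\<rho> permutes {..<n}" using assms(2) j_less by (intro permutes_swap_id) auto
  have "flip_bits n ?A u = replicate n False"
    using length_u by (intro nth_equalityI) auto
  moreover have "flip_bits n ?A (flip_bits n {j} u) = flip_bits n {j} (flip_bits n ?A u)"
    using flip_bits_comp by (metis Un_commute comp_apply)
  ultimately have "flip_bits n ?A ` e = axis_edge n j" by (simp add: e_eq axis_edge_def)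
  then have "permute_bits n ?\<rho> ` flip_bits n ?A ` e = axis_edge n i"
    by (simp add: permute_bits_axis_edge[OF transposition])
  then have "(permute_bits n ?\<rho> \<circ> flip_bits n ?A) ` e = axis_edge n i"
    by (simp only: image_comp)
  moreover have "permute_bits n ?\<rho> \<circ> flip_bits n ?A \<in> Aut (hypercube n)"
    by (intro Aut_comp permute_bits_Aut flip_bits_Aut transposition)
  ultimately show ?thesis using that by blast
qed

lemma flip_bits_axis_edge_eq_iff:
  assumes "A \<subseteq> {..<n}" and "i < n"
  shows "flip_bits n A ` axis_edge n i = axis_edge n i \<longleftrightarrow> A = {} \<or> A = {i}"
proof -
  let ?z = "replicate n False"
  have flip_zero_eq_iff: "flip_bits n A ?z = flip_bits n B ?z \<longleftrightarrow> A = B" if "B \<subseteq> {..<n}" for B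
    using flip_bits_eq_iff assms(1) that by simp
  show ?thesis
  proof
    assume "flip_bits n A ` axis_edge n i = axis_edge n i"
    then have "flip_bits n A ?z \<in> {flip_bits n {} ?z, flip_bits n {i} ?z}"
      by (auto simp: axis_edge_def flip_bits_empty)
    then show "A = {} \<or> A = {i}"
      using flip_zero_eq_iff[of "{}"] flip_zero_eq_iff[of "{i}"] assms(2) by auto
  next
    have "flip_bits n {i} (flip_bits n {i} ?z) = ?z"
      using fun_cong[OF flip_bits_comp[of n "{i}" "{i}"], of ?z] by (simp add: flip_bits_empty)
    then show "flip_bits n A ` axis_edge n i = axis_edge n i" if "A = {} \<or> A = {i}"
      using that by (auto simp: axis_edge_def flip_bits_empty)
  qed
qed


section \<open>Circuits and their automorphisms\<close>

locale hypercube_circuit =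
  fixes n :: nat and C :: "'g circuit"
  assumes circuit: "xor_circuit n C"

sublocale hypercube_circuit \<subseteq> dag: pair_fin_digraph "dag C"
  using circuit by (simp add: xor_circuit_def)

context hypercube_circuit
begin

lemma wf_wires: "wf ((wires C)\<inverse>)"
  using circuit dag.pair_finite_arcs by (simp add: xor_circuit_def finite_acyclic_wf_converse)

lemmas wires_induct = wf_induct_rule[OF wf_wires, simplified converse_iff, case_names gate]

lemma sources_eq: "{g \<in> gates C. \<forall>h. (h, g) \<notin> wires C} = {root C}"
  using circuit by (simp add: xor_circuit_def)

lemma root_gate: "root C \<in> gates C"
  using sources_eq by blast

lemma label_mem: "g \<in> input_gates C \<Longrightarrow> label C g \<in> graph_edges (hypercube n)"
  using circuit by (auto simp: xor_circuit_def)

lemma label_inj: "inj_on (label C) (input_gates C)"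
  using circuit by (simp add: xor_circuit_def)

context
  fixes \<sigma> :: "'g \<Rightarrow> 'g"
  assumes \<sigma>: "\<sigma> \<in> Aut (dag C)"
begin

lemma Aut_gate_iff: "\<sigma> g \<in> gates C \<longleftrightarrow> g \<in> gates C"
  by (rule permutes_in_image[OF Aut_permutes[OF \<sigma>]])

lemma Aut_surj: obtains g where "h = \<sigma> g"
  using bij_is_surj[OF Aut_bij[OF \<sigma>]] by blast

lemma Aut_eq_iff: "\<sigma> g = \<sigma> h \<longleftrightarrow> g = h"
  by (rule inj_eq[OF bij_is_inj[OF Aut_bij[OF \<sigma>]]])

lemma Aut_input_gate_iff: "\<sigma> g \<in> input_gates C \<longleftrightarrow> g \<in> input_gates C"
proof -
  have "(\<forall>h. (\<sigma> g, h) \<notin> wires C) \<longleftrightarrow> (\<forall>h. (g, h) \<notin> wires C)"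
    by (metis Aut_surj dag.Aut_arc_iff[OF \<sigma>])
  then show ?thesis by (simp add: input_gates_def Aut_gate_iff)
qed

lemma Aut_root: "\<sigma> (root C) = root C"
proof -
  have "(h, \<sigma> (root C)) \<notin> wires C" for h
  proof -
    obtain g where "h = \<sigma> g" by (rule Aut_surj)
    moreover have "(g, root C) \<notin> wires C" using sources_eq by blast
    ultimately show ?thesis by (simp add: dag.Aut_arc_iff[OF \<sigma>])
  qed
  then have "\<sigma> (root C) \<in> {g \<in> gates C. \<forall>h. (h, g) \<notin> wires C}"
    by (simp add: Aut_gate_iff root_gate)
  then show ?thesis unfolding sources_eq by simp
qed

lemma gate_value_Aut: "gate_value C a (\<sigma> g) = gate_value C (a \<circ> \<sigma>) g"
proof (induction g rule: wires_induct)
  case (gate g)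
  let ?X = "{h. (\<sigma> g, h) \<in> wires C \<and> gate_value C a h}"
  have "\<sigma> -` ?X = {h. (g, h) \<in> wires C \<and> gate_value C (a \<circ> \<sigma>) h}"
    using gate by (auto simp: dag.Aut_arc_iff[OF \<sigma>] simp del: comp_apply)
  moreover have "card (\<sigma> -` ?X) = card ?X"
    using Aut_bij[OF \<sigma>] by (intro card_vimage_inj) (auto simp: bij_def)
  ultimately show ?case
    by (subst (1 2) gate_value_unfold[OF circuit]) (simp add: Aut_input_gate_iff)
qed

end

lemma extends_to_Aut: "extends_to C \<pi> \<sigma> \<Longrightarrow> \<sigma> \<in> Aut (dag C)"
  by (simp add: extends_to_def)

lemma extends_to_label:
  "\<lbrakk>extends_to C \<pi> \<sigma>; g \<in> input_gates C\<rbrakk> \<Longrightarrow> label C (\<sigma> g) = \<pi> ` label C g"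
  by (simp add: extends_to_def)

lemma extends_to_id: "extends_to C id id"
  by (simp add: extends_to_def Aut_id)

lemma extends_to_comp:
  assumes "extends_to C \<pi> \<sigma>" and "extends_to C \<pi>' \<sigma>'"
  shows "extends_to C (\<pi> \<circ> \<pi>') (\<sigma> \<circ> \<sigma>')"
  using assms Aut_input_gate_iff[of \<sigma>']
  by (simp add: extends_to_def Aut_comp image_comp)

lemma extends_to_inv:
  assumes "extends_to C \<pi> \<sigma>" and "bij \<pi>"
  shows "extends_to C (inv \<pi>) (inv \<sigma>)"
proof -
  note \<sigma>_Aut = extends_to_Aut[OF assms(1)]
  have "label C (inv \<sigma> g) = inv \<pi> ` label C g" if "g \<in> input_gates C" for g
  proof -
    have \<sigma>_inv_g: "\<sigma> (inv \<sigma> g) = g" using Aut_bij[OF \<sigma>_Aut] by (simp add: bij_is_surj surj_f_inv_f)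
    then have "inv \<sigma> g \<in> input_gates C" using that Aut_input_gate_iff[OF \<sigma>_Aut] by metis
    then have "label C (\<sigma> (inv \<sigma> g)) = \<pi> ` label C (inv \<sigma> g)"
      by (rule extends_to_label[OF assms(1)])
    then have "label C g = \<pi> ` label C (inv \<sigma> g)" by (simp only: \<sigma>_inv_g)
    then show ?thesis using assms(2) by (simp add: bij_is_inj image_comp)
  qed
  then show ?thesis using Aut_inv[OF \<sigma>_Aut] by (simp add: extends_to_def)
qed

lemma extends_to_funpow:
  assumes "extends_to C \<pi> \<sigma>"
  shows "extends_to C (\<pi> ^^ t) (\<sigma> ^^ t)"
proof (induction t)
  case 0
  then show ?case using extends_to_id by (simp add: id_def)
next
  case (Suc t)
  then show ?case using extends_to_comp[OF assms Suc] by (simp add: comp_def)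
qed

lemma extends_to_fixed_label:
  assumes "extends_to C \<pi> \<sigma>" and "g \<in> input_gates C" and "\<pi> ` label C g = label C g"
  shows "\<sigma> g = g"
  using assms extends_to_label[OF assms(1,2)] Aut_input_gate_iff[OF extends_to_Aut[OF assms(1)]]
  by (auto intro: inj_onD[OF label_inj])

definition gate_stabilizer :: "'g \<Rightarrow> (bool list \<Rightarrow> bool list) set" where
  "gate_stabilizer g = {\<pi>. \<exists>\<sigma>. extends_to C \<pi> \<sigma> \<and> \<sigma> g = g}"

lemma gate_stabilizer_id: "id \<in> gate_stabilizer g"
  using extends_to_id by (auto simp: gate_stabilizer_def intro!: exI[of _ id])

lemma gate_stabilizer_comp:
  assumes "\<pi> \<in> gate_stabilizer g" and "\<pi>' \<in> gate_stabilizer g"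
  shows "\<pi> \<circ> \<pi>' \<in> gate_stabilizer g"
  using assms extends_to_comp by (fastforce simp: gate_stabilizer_def)

lemma inv_comp_mem_gate_stabilizer:
  assumes "extends_to C \<pi> \<sigma>" and "bij \<pi>" and "extends_to C \<pi>' \<sigma>'" and "\<sigma> g = \<sigma>' g"
  shows "inv \<pi> \<circ> \<pi>' \<in> gate_stabilizer g"
proof -
  have "(inv \<sigma> \<circ> \<sigma>') g = g"
    using Aut_bij[OF extends_to_Aut[OF assms(1)]] assms(4) by (metis bij_inv_eq_iff comp_apply)
  then show ?thesis
    using extends_to_comp[OF extends_to_inv[OF assms(1,2)] assms(3)]
    unfolding gate_stabilizer_def by blast
qed

lemma gate_stabilizer_inv:
  assumes "\<pi> \<in> gate_stabilizer g" and "bij \<pi>"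
  shows "inv \<pi> \<in> gate_stabilizer g"
proof -
  obtain \<sigma> where "extends_to C \<pi> \<sigma>" "\<sigma> g = g" using assms(1) by (auto simp: gate_stabilizer_def)
  then show ?thesis
    using inv_comp_mem_gate_stabilizer[OF _ assms(2) extends_to_id] by simp
qed


subsection \<open>Dependence of gates on input gates\<close>

text \<open>
  Gates compute linear functions, so a gate depends on the input gate \<open>e\<close> iff it has value
  \<open>True\<close> at the unit vector of \<open>e\<close>.
\<close>

definition depends_on :: "'g \<Rightarrow> 'g \<Rightarrow> bool" where
  "depends_on g e \<longleftrightarrow> gate_value C (\<lambda>h. h = e) g"

lemma depends_on_input_gate: "g \<in> input_gates C \<Longrightarrow> depends_on g e \<longleftrightarrow> g = e"
  unfolding depends_on_def by (subst gate_value_unfold[OF circuit]) simp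

lemma depends_on_inner_gate:
  "g \<notin> input_gates C \<Longrightarrow> depends_on g e \<longleftrightarrow> odd (card {h. (g, h) \<in> wires C \<and> depends_on h e})"
  unfolding depends_on_def by (subst gate_value_unfold[OF circuit]) simp

lemma depends_on_Aut:
  assumes "\<sigma> \<in> Aut (dag C)"
  shows "depends_on (\<sigma> g) (\<sigma> e) \<longleftrightarrow> depends_on g e"
  by (simp add: depends_on_def gate_value_Aut[OF assms] comp_def Aut_eq_iff[OF assms])

lemma gate_value_False: "\<not> gate_value C (\<lambda>_. False) g"
proof (induction g rule: wires_induct)
  case (gate g)
  then have no_true_child: "{h. (g, h) \<in> wires C \<and> gate_value C (\<lambda>_. False) h} = {}" by auto
  show ?case by (subst gate_value_unfold[OF circuit]) (simp add: no_true_child)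
qed

lemma root_depends_on_if_sensitive:
  assumes "sensitive_to C e"
  shows "depends_on (root C) e"
proof -
  have "circuit_output C ((\<lambda>_. False)(e := True)) \<noteq> circuit_output C (\<lambda>_. False)"
    using assms unfolding sensitive_to_def by (metis (full_types))
  moreover have "(\<lambda>_. False)(e := True) = (\<lambda>h. h = e)" by (simp add: fun_eq_iff)
  ultimately show ?thesis by (simp add: depends_on_def circuit_output_def gate_value_False)
qed

text \<open>The children of \<open>g\<close> that depend on \<open>e\<close> are odd in number and permuted by \<open>\<sigma>\<close>.\<close>

lemma fixed_dependent_child:
  assumes automorphism: "\<sigma> \<in> Aut (dag C)" "\<sigma> ^^ (2 ^ a) = id" "\<sigma> e = e" "\<sigma> g = g"
    and dependent: "depends_on g e" "g \<notin> input_gates C"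
  obtains h where "(g, h) \<in> wires C" and "\<sigma> h = h" and "depends_on h e"
proof -
  let ?X = "{h. (g, h) \<in> wires C \<and> depends_on h e}"
  have "odd (card ?X)" using dependent depends_on_inner_gate by blast
  moreover have "finite ?X"
    by (rule finite_subset[OF _ dag.pair_finite_verts]) (auto dest: dag.in_arcsD2)
  moreover have "\<sigma> ` ?X \<subseteq> ?X"
    using dag.Aut_arc_iff[OF automorphism(1), of g] depends_on_Aut[OF automorphism(1), of _ e]
      automorphism(3,4)
    by auto
  ultimately have "\<exists>h\<in>?X. \<sigma> h = h"
    using automorphism(2) by (intro odd_card_imp_fixpoint[where a = a]) auto
  then show ?thesis using that by blast
qed

text \<open>
  Following fixed dependent children from the root ends at \<open>e\<close>, so \<open>P\<close> has to fail on the way.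
\<close>

lemma fixed_wire_leaving:
  assumes automorphism: "\<sigma> \<in> Aut (dag C)" "\<sigma> ^^ (2 ^ a) = id" "\<sigma> e = e"
    and root: "depends_on (root C) e" "P (root C)" and "\<not> P e"
  obtains g h where "(g, h) \<in> wires C" and "\<sigma> h = h" and "P g" and "\<not> P h"
proof -
  have "\<exists>g h. (g, h) \<in> wires C \<and> \<sigma> h = h \<and> P g \<and> \<not> P h"
    if "\<sigma> g = g" "depends_on g e" "P g" for g
    using that
  proof (induction g rule: wires_induct)
    case (gate g)
    have "g \<notin> input_gates C"
      using gate.prems \<open>\<not> P e\<close> depends_on_input_gate[of g e] by auto
    then obtain h where "(g, h) \<in> wires C" "\<sigma> h = h" "depends_on h e"
      using fixed_dependent_child[OF automorphism] gate.prems by blast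
    then show ?case using gate by (cases "P h") blast+
  qed
  then show ?thesis using that root Aut_root[OF automorphism(1)] by blast
qed


subsection \<open>Stabilizers of gates in the group of bit flips\<close>

definition flip_stabilizer :: "nat set \<Rightarrow> 'g \<Rightarrow> nat set set" where
  "flip_stabilizer I g = {A. A \<subseteq> I \<and> flip_bits n A \<in> gate_stabilizer g}"

lemma flip_stabilizer_empty: "{} \<in> flip_stabilizer I g"
  by (simp add: flip_stabilizer_def flip_bits_empty gate_stabilizer_id)

lemma flip_stabilizer_sym_diff:
  assumes "A \<in> flip_stabilizer I g" and "B \<in> flip_stabilizer I g"
  shows "sym_diff A B \<in> flip_stabilizer I g"
  using assms gate_stabilizer_comp[of "flip_bits n A" g "flip_bits n B"]
  by (auto simp: flip_stabilizer_def flip_bits_comp)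

lemma sym_diff_mem_flip_stabilizer:
  assumes "A \<subseteq> I" and "B \<subseteq> I" and "extends_to C (flip_bits n A) \<sigma>"
    and "extends_to C (flip_bits n B) \<sigma>'" and "\<sigma> g = \<sigma>' g"
  shows "sym_diff A B \<in> flip_stabilizer I g"
  using assms(1,2) inv_comp_mem_gate_stabilizer[OF assms(3) Aut_bij[OF flip_bits_Aut] assms(4,5)]
  by (auto simp: flip_stabilizer_def inv_flip_bits flip_bits_comp)

lemma finite_flip_stabilizer: "finite I \<Longrightarrow> finite (flip_stabilizer I g)"
  by (rule finite_subset[of _ "Pow I"]) (auto simp: flip_stabilizer_def)

lemma flip_stabilizer_permute:
  assumes perm: "\<rho> permutes I" and "I \<subseteq> {..<n}" and "permute_bits n \<rho> \<in> gate_stabilizer g"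
    and A_mem: "A \<in> flip_stabilizer I g"
  shows "\<rho> -` A \<in> flip_stabilizer I g"
proof -
  have perm_n: "\<rho> permutes {..<n}" using assms(1,2) by (rule permutes_subset)
  have bij: "bij (permute_bits n \<rho>)" by (rule Aut_bij[OF permute_bits_Aut[OF perm_n]])
  then have "flip_bits n (\<rho> -` A) = permute_bits n \<rho> \<circ> flip_bits n A \<circ> inv (permute_bits n \<rho>)"
    by (simp add: permute_bits_flip_bits[OF perm_n] comp_assoc bij_is_surj surj_iff[THEN iffD1])
  then have "flip_bits n (\<rho> -` A) \<in> gate_stabilizer g"
    using assms(3) A_mem bij
    by (auto simp: flip_stabilizer_def intro!: gate_stabilizer_comp gate_stabilizer_inv)
  moreover have "\<rho> -` A \<subseteq> I"
    using A_mem permutes_in_image[OF perm] by (auto simp: flip_stabilizer_def)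
  ultimately show ?thesis by (simp add: flip_stabilizer_def)
qed

lemma cyclic_code_flip_stabilizer:
  assumes "m \<le> n" and "permute_bits n (cyclic_shift m) \<in> gate_stabilizer g"
  shows "cyclic_code m (flip_stabilizer {..<m} g)"
proof
  show "finite (flip_stabilizer {..<m} g)" by (simp add: finite_flip_stabilizer)
  show "flip_stabilizer {..<m} g \<subseteq> Pow {..<m}" by (auto simp: flip_stabilizer_def)
  show "cyclic_shift m -` A \<in> flip_stabilizer {..<m} g" if "A \<in> flip_stabilizer {..<m} g" for A
    using cyclic_shift_permutes _ assms(2) that
    by (rule flip_stabilizer_permute) (use assms(1) in auto)
qed (fact flip_stabilizer_empty flip_stabilizer_sym_diff)+

lemma flip_stabilizer_axis_edge:
  assumes "e \<in> input_gates C" and "label C e = axis_edge n i" and "i < n" and "I \<subseteq> {..<n} - {i}"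
  shows "flip_stabilizer I e = {{}}"
proof -
  have "A = {}" if stab: "A \<in> flip_stabilizer I e" for A
  proof -
    obtain \<sigma> where A_subset: "A \<subseteq> I" and extension: "extends_to C (flip_bits n A) \<sigma>" "\<sigma> e = e"
      using stab by (auto simp: flip_stabilizer_def gate_stabilizer_def)
    then have "flip_bits n A ` axis_edge n i = axis_edge n i"
      using extends_to_label[OF extension(1) assms(1)] assms(2) by simp
    then show ?thesis using A_subset assms(3,4) by (subst (asm) flip_bits_axis_edge_eq_iff) auto
  qed
  then show ?thesis using flip_stabilizer_empty by blast
qed

end


subsection \<open>Symmetric circuits\<close>

locale symmetric_circuit = hypercube_circuit +
  assumes symmetric: "\<pi> \<in> Aut (hypercube n) \<Longrightarrow> \<exists>\<sigma>. extends_to C \<pi> \<sigma>"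
begin

lemma two_power_order_extension:
  assumes "\<pi> \<in> Aut (hypercube n)" and "\<pi> ^^ (2 ^ k) = id"
  obtains \<sigma> a where "extends_to C \<pi> \<sigma>" and "\<sigma> ^^ (2 ^ a) = id"
proof -
  obtain \<sigma> where extension: "extends_to C \<pi> \<sigma>" using symmetric[OF assms(1)] by blast
  then have "permutation \<sigma>"
    using Aut_permutes[OF extends_to_Aut] dag.pair_finite_verts
    unfolding permutation_permutes by blast
  then obtain s where "\<sigma> ^^ s = id" "s > 0" by (rule permutation_is_nilpotent)
  then obtain r a where r_cong: "[r = 1] (mod 2 ^ k)" and order: "(\<sigma> ^^ r) ^^ (2 ^ a) = id"
    by (rule power_of_two_power_order)
  have "\<pi> ^^ r = \<pi>" using funpow_cong_eq[OF assms(2) r_cong] by simp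
  then have "extends_to C \<pi> (\<sigma> ^^ r)" using extends_to_funpow[OF extension, of r] by simp
  then show ?thesis using order by (rule that)
qed

lemma root_depends_on_axis_edge:
  assumes "sensitive_to C s" and "i < n"
  obtains e where "e \<in> input_gates C" and "label C e = axis_edge n i" and "depends_on (root C) e"
proof -
  have input: "s \<in> input_gates C" using assms(1) by (simp add: sensitive_to_def)
  obtain \<pi> where to_axis: "\<pi> \<in> Aut (hypercube n)" "\<pi> ` label C s = axis_edge n i"
    using label_mem[OF input] assms(2) by (rule hypercube_edge_transitive)
  then obtain \<sigma> where extension: "extends_to C \<pi> \<sigma>" using symmetric by blast
  note \<sigma>_Aut = extends_to_Aut[OF extension]
  have "depends_on (root C) (\<sigma> s)"
    using root_depends_on_if_sensitive[OF assms(1)] depends_on_Aut[OF \<sigma>_Aut, of "root C" s]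
    by (simp add: Aut_root[OF \<sigma>_Aut])
  moreover have "label C (\<sigma> s) = axis_edge n i"
    using extends_to_label[OF extension input] to_axis(2) by simp
  moreover have "\<sigma> s \<in> input_gates C" using input Aut_input_gate_iff[OF \<sigma>_Aut] by simp
  ultimately show ?thesis using that by blast
qed

lemma flip_stabilizer_root: "flip_stabilizer I (root C) = Pow I"
proof -
  have "flip_bits n A \<in> gate_stabilizer (root C)" for A
    using symmetric[OF flip_bits_Aut] Aut_root extends_to_Aut unfolding gate_stabilizer_def by blast
  then show ?thesis by (auto simp: flip_stabilizer_def)
qed

lemma card_flip_stabilizer_le:
  assumes "h \<in> gates C" and "finite I"
  shows "card (flip_stabilizer I g) \<le> card (orbit_fixing n C g h) * card (flip_stabilizer I h)"
proof -
  let ?W = "flip_stabilizer I"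
  have "\<forall>A\<in>?W g. \<exists>\<sigma>. extends_to C (flip_bits n A) \<sigma> \<and> \<sigma> g = g"
    by (simp add: flip_stabilizer_def gate_stabilizer_def)
  then obtain S where lift: "\<And>A. A \<in> ?W g \<Longrightarrow> extends_to C (flip_bits n A) (S A) \<and> S A g = g"
    by metis
  let ?images = "(\<lambda>A. S A h) ` ?W g"
  let ?fibre = "\<lambda>y. {A \<in> ?W g. S A h = y}"
  have "card (?fibre y) \<le> card (?W h)" if y_image: "y \<in> ?images" for y
  proof -
    obtain B where B_mem: "B \<in> ?W g" "S B h = y" using y_image by blast
    have "sym_diff B A \<in> ?W h" if "A \<in> ?fibre y" for A
      using that B_mem lift[of A] lift[of B]
      by (intro sym_diff_mem_flip_stabilizer[where \<sigma> = "S B" and \<sigma>' = "S A"])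
        (auto simp: flip_stabilizer_def)
    moreover have "inj_on (sym_diff B) (?fibre y)" by (rule inj_onI) blast
    ultimately show ?thesis
      using assms(2) by (intro card_inj_on_le[of "sym_diff B"] finite_flip_stabilizer) auto
  qed
  then have "card (?W g) \<le> card ?images * card (?W h)"
    unfolding card_eq_sum_card_fibres[OF finite_flip_stabilizer[OF assms(2)], of g "\<lambda>A. S A h"]
    using sum_bounded_above[of ?images "\<lambda>y. card (?fibre y)"] by simp
  moreover have "orbit_fixing n C g h \<subseteq> gates C"
    using assms(1) Aut_gate_iff extends_to_Aut by (auto simp: orbit_fixing_def)
  then have "card ?images \<le> card (orbit_fixing n C g h)"
  proof (intro card_mono)
    show "?images \<subseteq> orbit_fixing n C g h"
      using lift flip_bits_Aut unfolding orbit_fixing_def by blast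
  qed (auto intro: finite_subset dag.pair_finite_verts)
  ultimately show ?thesis by (meson mult_le_mono1 order_trans)
qed

lemma fixed_gate_with_intermediate_flip_stabilizer:
  assumes automorphism: "\<sigma> \<in> Aut (dag C)" "\<sigma> ^^ (2 ^ a) = id" "\<sigma> e = e"
    and root: "depends_on (root C) e" and "finite I"
    and orbits: "\<And>g h. (g, h) \<in> wires C \<Longrightarrow> card (orbit_fixing n C g h) \<le> b"
    and "c < 2 ^ card I" and "card (flip_stabilizer I e) \<le> c"
  obtains g where "g \<in> gates C" and "\<sigma> g = g"
    and "card (flip_stabilizer I g) \<le> c" and "c < b * card (flip_stabilizer I g)"
proof -
  have "c < card (flip_stabilizer I (root C))"
    using assms by (simp add: flip_stabilizer_root card_Pow)
  then obtain g h where wire: "(g, h) \<in> wires C" "\<sigma> h = h"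
    and crossing: "c < card (flip_stabilizer I g)" "\<not> c < card (flip_stabilizer I h)"
    using fixed_wire_leaving[OF automorphism root, of "\<lambda>g. c < card (flip_stabilizer I g)"] assms(8)
    by auto
  have "h \<in> gates C" using wire(1) by (rule dag.in_arcsD2)
  moreover have "c < b * card (flip_stabilizer I h)"
    using crossing(1) card_flip_stabilizer_le[OF \<open>h \<in> gates C\<close> \<open>finite I\<close>] orbits[OF wire(1)]
    by (meson less_le_trans mult_le_mono1)
  ultimately show ?thesis using that wire(2) crossing(2) by simp
qed

lemma trivial_stabilizer_imp_fact_le_card_gates:
  assumes "g \<in> gates C" and "J \<subseteq> {..<n}"
    and trivial: "\<And>\<rho>. \<lbrakk>\<rho> permutes J; permute_bits n \<rho> \<in> gate_stabilizer g\<rbrakk> \<Longrightarrow> \<rho> = id"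
  shows "fact (card J) \<le> card (gates C)"
proof -
  let ?P = "{\<rho>. \<rho> permutes J}"
  have perm_n: "\<rho> permutes {..<n}" if "\<rho> \<in> ?P" for \<rho>
    using that assms(2) by (auto intro: permutes_subset)
  have "\<forall>\<rho>\<in>?P. \<exists>\<sigma>. extends_to C (permute_bits n \<rho>) \<sigma>"
    using symmetric permute_bits_Aut perm_n by blast
  then obtain S where lift: "\<And>\<rho>. \<rho> \<in> ?P \<Longrightarrow> extends_to C (permute_bits n \<rho>) (S \<rho>)"
    by metis
  have "inj_on (\<lambda>\<rho>. S \<rho> g) ?P"
  proof (rule inj_onI)
    fix \<rho> \<rho>'
    assume perm: "\<rho> \<in> ?P" and perm': "\<rho>' \<in> ?P" and images_eq: "S \<rho> g = S \<rho>' g"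
    have "inv (permute_bits n \<rho>) \<circ> permute_bits n \<rho>' \<in> gate_stabilizer g"
      using lift[OF perm] Aut_bij[OF permute_bits_Aut[OF perm_n[OF perm]]] lift[OF perm'] images_eq
      by (rule inv_comp_mem_gate_stabilizer)
    then have "permute_bits n (\<rho>' \<circ> inv \<rho>) \<in> gate_stabilizer g"
      using perm_n[OF perm] by (simp add: inv_permute_bits permute_bits_comp permutes_inv)
    moreover have "\<rho>' \<circ> inv \<rho> permutes J"
      using perm perm' by (intro permutes_compose permutes_inv) auto
    ultimately have "\<rho>' \<circ> inv \<rho> = id" by (intro trivial)
    then show "\<rho> = \<rho>'"
      using perm by (metis comp_assoc comp_id id_comp mem_Collect_eq permutes_inv_o(2))
  qed
  moreover have "(\<lambda>\<rho>. S \<rho> g) ` ?P \<subseteq> gates C"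
    using lift assms(1) Aut_gate_iff extends_to_Aut by blast
  ultimately have "card ?P \<le> card (gates C)"
    using dag.pair_finite_verts by (rule card_inj_on_le)
  moreover have "card ?P = fact (card J)"
    using assms(2) by (intro card_permutations) (auto intro: finite_subset)
  ultimately show ?thesis by simp
qed

lemma intermediate_flip_stabilizer_imp_fact_le_card_gates:
  assumes "4 * q \<le> n" and q_power: "q = 2 ^ k" and "g \<in> gates C"
    and "permute_bits n (cyclic_shift (4 * q)) \<in> gate_stabilizer g"
    and card: "2 ^ q < card (flip_stabilizer {..<4 * q} g)"
      "card (flip_stabilizer {..<4 * q} g) \<le> 2 ^ (2 * q)"
  shows "fact (2 * q) \<le> card (gates C)"
proof -
  interpret cyclic_code "4 * q" "flip_stabilizer {..<4 * q} g"
    using assms(1,4) by (rule cyclic_code_flip_stabilizer)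
  have "\<rho> = id"
    if upper: "\<rho> permutes {2 * q..<4 * q}" and stab: "permute_bits n \<rho> \<in> gate_stabilizer g" for \<rho>
  proof (rule upper_half_stabilizer_trivial[OF refl q_power card upper])
    have "\<rho> permutes {..<4 * q}" using upper by (rule permutes_subset) auto
    then show "\<rho> -` A \<in> flip_stabilizer {..<4 * q} g" if "A \<in> flip_stabilizer {..<4 * q} g" for A
      using stab that assms(1) by (intro flip_stabilizer_permute) auto
  qed
  then have "fact (card {2 * q..<4 * q}) \<le> card (gates C)"
    using assms(1,3) by (intro trivial_stabilizer_imp_fact_le_card_gates) auto
  then show ?thesis by simp
qed

theorem sensitive_imp_fact_le_card_gates:
  assumes n_eq: "n = Suc (4 * q)" and q_power: "q = 2 ^ k" and sensitive: "sensitive_to C s"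
    and orbits: "\<And>g h. (g, h) \<in> wires C \<Longrightarrow> card (orbit_fixing n C g h) \<le> 2 ^ q"
  shows "fact (2 * q) \<le> card (gates C)"
proof -
  let ?m = "4 * q"
  let ?I = "{..<?m}"
  let ?\<tau> = "permute_bits n (cyclic_shift ?m)"
  have shift: "cyclic_shift ?m permutes {..<n}"
    using cyclic_shift_permutes by (rule permutes_subset) (simp add: n_eq)
  obtain e where leaf: "e \<in> input_gates C" "label C e = axis_edge n ?m"
    and root: "depends_on (root C) e"
    using sensitive by (rule root_depends_on_axis_edge[of s ?m]) (simp add: n_eq)
  have "?\<tau> ^^ ?m = id"
    by (simp add: funpow_permute_bits[OF shift] funpow_cyclic_shift_self permute_bits_id)
  moreover have "?m = 2 ^ (k + 2)" by (simp add: q_power)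
  ultimately obtain \<sigma> a where extension: "extends_to C ?\<tau> \<sigma>" and order: "\<sigma> ^^ (2 ^ a) = id"
    using two_power_order_extension[OF permute_bits_Aut[OF shift]] by metis
  have "inv (cyclic_shift ?m) ?m = ?m"
    using permutes_inv[OF cyclic_shift_permutes] by (rule permutes_not_in) simp
  then have "?\<tau> ` label C e = label C e" by (simp add: leaf(2) permute_bits_axis_edge[OF shift])
  then have "\<sigma> e = e" by (rule extends_to_fixed_label[OF extension leaf(1)])
  moreover have "flip_stabilizer ?I e = {{}}"
    using leaf by (rule flip_stabilizer_axis_edge) (auto simp: n_eq)
  ultimately obtain g where fixed_gate: "g \<in> gates C" "\<sigma> g = g"
    and card: "card (flip_stabilizer ?I g) \<le> 2 ^ (2 * q)"
      "2 ^ (2 * q) < 2 ^ q * card (flip_stabilizer ?I g)"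
    using fixed_gate_with_intermediate_flip_stabilizer
      [OF extends_to_Aut[OF extension] order _ root _ orbits, of ?I "2 ^ (2 * q)"]
    by (auto simp: q_power)
  show ?thesis
  proof (rule intermediate_flip_stabilizer_imp_fact_le_card_gates[OF _ q_power fixed_gate(1)])
    show "?\<tau> \<in> gate_stabilizer g" using extension fixed_gate(2) by (auto simp: gate_stabilizer_def)
    show "2 ^ q < card (flip_stabilizer ?I g)" using card(2) by (simp add: mult_2 power_add)
  qed (use card(1) in \<open>simp_all add: n_eq\<close>)
qed

end


section \<open>Treewidth of the hypercube\<close>

lemma single_bag_decomposition:
  assumes "pair_wf_digraph G"
  shows "tree_decomposition G \<lparr>pverts = {0 :: nat}, parcs = {}\<rparr> (\<lambda>_. pverts G)"
proof -
  let ?T = "\<lparr>pverts = {0 :: nat}, parcs = {}\<rparr>"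
  have connected: "Digraph_Component.connected H"
    if "verts H = {0}" for H :: "(nat, nat \<times> nat) pre_digraph"
    using that by (simp add: Digraph_Component.connected_def strongly_connected_def reachable_def)
  have "pair_graph ?T"
    by unfold_locales (auto simp: symmetric_def sym_def arcs_ends_def)
  moreover have "\<not> pre_digraph.cycle (with_proj ?T) p" for p
    by (auto simp: pre_digraph.cycle_def pre_digraph.awalk_def)
  ultimately have "undirected_tree ?T"
    by (simp add: undirected_tree_def connected)
  moreover have "e \<subseteq> pverts G" if "e \<in> graph_edges G" for e
    using that assms by (force simp: graph_edges_def pair_wf_digraph_def)
  ultimately show ?thesis
    by (simp add: tree_decomposition_def connected)
qed

lemma treewidth_attained:
  assumes "pair_wf_digraph G"
  obtains T :: "nat pair_pre_digraph" and bag
  where "tree_decomposition G T bag" and "decomposition_width T bag = treewidth G"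
proof -
  have "\<exists>w (T :: nat pair_pre_digraph) bag. tree_decomposition G T bag \<and> decomposition_width T bag = w"
    using single_bag_decomposition[OF assms] by blast
  from LeastI_ex[OF this] show ?thesis
    using that unfolding treewidth_def by blast
qed

lemma treewidth_pos:
  assumes "pair_wf_digraph G" and "finite (pverts G)" and "(u, v) \<in> parcs G" and "u \<noteq> v"
  shows "0 < treewidth G"
proof -
  obtain T :: "nat pair_pre_digraph" and bag
    where decomposition: "tree_decomposition G T bag" "decomposition_width T bag = treewidth G"
    using assms(1) by (rule treewidth_attained)
  have "finite (pverts T)"
    using decomposition(1)
    by (auto simp: tree_decomposition_def undirected_tree_def pair_graph_def pair_digraph_def
        pair_fin_digraph_def pair_fin_digraph_axioms_def)
  have "{u, v} \<in> graph_edges G" using assms(3) by (auto simp: graph_edges_def)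
  then obtain t where bag_t: "t \<in> pverts T" "{u, v} \<subseteq> bag t"
    using decomposition(1) unfolding tree_decomposition_def by blast
  have "bag t \<subseteq> pverts G" using decomposition(1) bag_t(1) by (auto simp: tree_decomposition_def)
  then have "finite (bag t)" using assms(2) by (rule finite_subset)
  then have "2 \<le> card (bag t)" using bag_t(2) assms(4) card_mono[of "bag t" "{u, v}"] by simp
  also have "card (bag t) \<le> Max ((\<lambda>t. card (bag t)) ` pverts T)"
    using bag_t(1) \<open>finite (pverts T)\<close> by (intro Max_ge) auto
  finally show ?thesis using decomposition(2) by (simp add: decomposition_width_def)
qed

lemma treewidth_hypercube_pos:
  assumes "n > 0"
  shows "0 < treewidth (hypercube n)"
proof (rule treewidth_pos)
  let ?z = "replicate n False"
  show "pair_wf_digraph (hypercube n)"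
    by unfold_locales (auto simp: hypercube_def)
  show "finite (pverts (hypercube n))"
    using finite_lists_length_eq[of "UNIV :: bool set" n] by (simp add: hypercube_def)
  show "(?z, flip_bits n {0} ?z) \<in> parcs (hypercube n)"
    using assms by (auto simp: parcs_hypercube_iff)
  show "?z \<noteq> flip_bits n {0} ?z"
    using flip_bits_eq_iff[of ?z n "{}" "{0}"] assms by (simp add: flip_bits_empty)
qed


section \<open>Growth rates\<close>

lemma poly_le_power:
  fixes p :: "real poly"
  obtains B where "B > 0" and "\<And>x. x \<ge> 1 \<Longrightarrow> poly p x \<le> B * x ^ degree p"
proof
  let ?B = "1 + (\<Sum>i\<le>degree p. \<bar>coeff p i\<bar>)"
  show "0 < ?B" by (intro add_pos_nonneg sum_nonneg) auto
  fix x :: real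
  assume x_ge_1: "1 \<le> x"
  have "poly p x = (\<Sum>i\<le>degree p. coeff p i * x ^ i)" by (rule poly_altdef)
  also have "\<dots> \<le> (\<Sum>i\<le>degree p. \<bar>coeff p i\<bar> * x ^ degree p)"
    using x_ge_1 by (intro sum_mono mult_mono power_increasing) auto
  also have "\<dots> \<le> ?B * x ^ degree p"
    using x_ge_1 by (simp add: sum_distrib_right[symmetric] mult_right_mono)
  finally show "poly p x \<le> ?B * x ^ degree p" .
qed

lemma eventually_exponential_less_fact:
  fixes c d :: real
  shows "\<forall>\<^sub>F n in sequentially. d * c ^ n < fact n"
proof -
  have "(\<lambda>n. c ^ n / fact n) \<longlonglongrightarrow> 0"
    using summable_LIMSEQ_zero[OF summable_exp[of c]] by (simp add: field_simps)
  then have "(\<lambda>n. d * (c ^ n / fact n)) \<longlonglongrightarrow> 0" by (rule tendsto_mult_right_zero)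
  then have "\<forall>\<^sub>F n in sequentially. d * (c ^ n / fact n) < 1" by (rule order_tendstoD) simp
  then show ?thesis by eventually_elim (simp add: field_simps)
qed

lemma cfi_size_ge_1: "1 \<le> cfi_size n"
  by (simp add: cfi_size_def Suc_le_eq)

lemma cfi_size_le: "cfi_size n \<le> 2 ^ Suc (2 * n)"
proof -
  have "(2 :: nat) ^ (2 * n - 1) \<le> 2 ^ (2 * n)" by (intro power_increasing) auto
  moreover have "n * 2 ^ n \<le> 2 ^ n * 2 ^ n" by (intro mult_right_mono less_imp_le[OF less_exp]) simp
  ultimately have "cfi_size n \<le> 2 ^ (2 * n) + 2 ^ n * 2 ^ n"
    unfolding cfi_size_def by (rule add_mono)
  also have "\<dots> = 2 ^ Suc (2 * n)" by (simp add: mult_2 power_add)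
  finally show ?thesis .
qed

lemma log_cfi_size_le: "log 2 (real (cfi_size n)) \<le> real (2 * n + 1)"
proof -
  have "real (cfi_size n) \<le> 2 ^ Suc (2 * n)"
    using of_nat_mono[OF cfi_size_le[of n], where 'a = real] by simp
  then have "log 2 (real (cfi_size n)) \<le> log 2 (2 ^ Suc (2 * n))"
    using cfi_size_ge_1[of n] by (intro log_mono) auto
  then show ?thesis by (simp only: log_nat_power log_eq_one) simp
qed

lemma eventually_log_cfi_size_le_exponential:
  "\<forall>\<^sub>F q in sequentially. K * log 2 (real (cfi_size (Suc (4 * q)))) \<le> 2 ^ q"
proof -
  have "\<forall>\<^sub>F q in sequentially. \<bar>K\<bar> * real (2 * Suc (4 * q) + 1) \<le> 2 ^ q" by real_asymp
  then show ?thesis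
  proof eventually_elim
    case (elim q)
    let ?log = "log 2 (real (cfi_size (Suc (4 * q))))"
    have "K * ?log \<le> \<bar>K\<bar> * ?log"
      using cfi_size_ge_1[of "Suc (4 * q)"] by (intro mult_right_mono) auto
    also have "\<dots> \<le> \<bar>K\<bar> * real (2 * Suc (4 * q) + 1)"
      by (intro mult_left_mono log_cfi_size_le) simp
    finally show ?case using elim by linarith
  qed
qed

lemma eventually_poly_cfi_size_less_fact:
  fixes p :: "real poly"
  shows "\<forall>\<^sub>F q in sequentially. poly p (real (cfi_size (Suc (4 * q)))) < fact (2 * q)"
proof -
  define d where "d = degree p"
  obtain B where poly_bound: "B > 0" "\<And>x. x \<ge> 1 \<Longrightarrow> poly p x \<le> B * x ^ d"
    using poly_le_power[of p, folded d_def] by blast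
  have "filterlim (\<lambda>q :: nat. 2 * q) sequentially sequentially" by real_asymp
  with eventually_exponential_less_fact[of "B * 8 ^ d" "16 ^ d"]
  have "\<forall>\<^sub>F q in sequentially. B * 8 ^ d * (16 ^ d) ^ (2 * q) < fact (2 * q)"
    by (rule eventually_compose_filterlim)
  then show ?thesis
  proof eventually_elim
    case (elim q)
    let ?N = "real (cfi_size (Suc (4 * q)))"
    have "poly p ?N \<le> B * ?N ^ d"
      using poly_bound(2)[of ?N] cfi_size_ge_1[of "Suc (4 * q)"] by simp
    also have "\<dots> \<le> B * (2 ^ Suc (2 * Suc (4 * q))) ^ d"
      using poly_bound(1) of_nat_mono[OF cfi_size_le[of "Suc (4 * q)"], where 'a = real]
      by (intro mult_left_mono power_mono) auto
    also have "(2 :: real) ^ Suc (2 * Suc (4 * q)) = 8 * 16 ^ (2 * q)"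
      by (simp add: power_mult)
    also have "B * (8 * 16 ^ (2 * q)) ^ d = B * 8 ^ d * (16 ^ d) ^ (2 * q)"
      by (simp add: power_mult_distrib power_mult[symmetric] mult.commute)
    finally show ?case using elim by linarith
  qed
qed

lemma filterlim_eventually_imp_frequently:
  assumes "filterlim f G F" and "F \<noteq> bot" and "\<forall>\<^sub>F x in F. P (f x)"
  shows "\<exists>\<^sub>F y in G. P y"
  unfolding frequently_def
proof
  assume "\<forall>\<^sub>F y in G. \<not> P y"
  then have "\<forall>\<^sub>F x in F. \<not> P (f x)" using assms(1) by (rule eventually_compose_filterlim)
  with assms(3) have "\<forall>\<^sub>F x in F. False" by eventually_elim simp
  then show False using assms(2) by simp
qed

lemma eventually_sensitive_if_treewidth_le:
  assumes "c > 0"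
    and "\<forall>\<^sub>F n in sequentially.
      c * real (treewidth (hypercube n)) \<le> real (card {g. sensitive_to (C n) g})"
  shows "\<forall>\<^sub>F n in sequentially. \<exists>s. sensitive_to (C n) s"
  using assms(2) eventually_gt_at_top[of 0]
proof eventually_elim
  case (elim n)
  have "0 < c * real (treewidth (hypercube n))"
    using assms(1) treewidth_hypercube_pos[OF elim(2)] by simp
  with elim(1) have "card {g. sensitive_to (C n) g} \<noteq> 0" by linarith
  then show ?case by (metis card.empty empty_Collect_eq)
qed

lemma symmetric_circuits_superpolynomial:
  fixes C :: "nat \<Rightarrow> 'g circuit"
  assumes circuits: "\<And>n. n \<ge> 1 \<Longrightarrow> symmetric_circuit n (C n)"
    and sensitive: "\<forall>\<^sub>F n in sequentially. \<exists>s. sensitive_to (C n) s"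
    and orbits: "\<forall>\<^sub>F n in sequentially. \<forall>g h. (g, h) \<in> wires (C n) \<longrightarrow>
      real (card (orbit_fixing n (C n) g h)) \<le> K * log 2 (real (cfi_size n))"
  shows "\<exists>\<^sub>F n in sequentially. poly p (real (cfi_size n)) < real (card (gates (C n)))"
    (is "\<exists>\<^sub>F n in sequentially. ?large n")
proof -
  have dim_at_top: "filterlim (\<lambda>k. Suc (4 * 2 ^ k)) sequentially sequentially"
    and pow_at_top: "filterlim (\<lambda>k. 2 ^ k :: nat) sequentially sequentially" by real_asymp+
  note eventually_dim = eventually_compose_filterlim[OF _ dim_at_top]
    and eventually_pow = eventually_compose_filterlim[OF _ pow_at_top]
  have "\<forall>\<^sub>F k in sequentially. ?large (Suc (4 * 2 ^ k))"
    using eventually_dim[OF sensitive] eventually_dim[OF orbits]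
      eventually_pow[OF eventually_log_cfi_size_le_exponential[of K]]
      eventually_pow[OF eventually_poly_cfi_size_less_fact[of p]]
  proof eventually_elim
    case (elim k)
    let ?n = "Suc (4 * 2 ^ k)"
    interpret symmetric_circuit ?n "C ?n" by (rule circuits) simp
    have "card (orbit_fixing ?n (C ?n) g h) \<le> 2 ^ 2 ^ k" if "(g, h) \<in> wires (C ?n)" for g h
    proof -
      have "real (card (orbit_fixing ?n (C ?n) g h)) \<le> K * log 2 (real (cfi_size ?n))"
        using elim(2) that by blast
      also have "\<dots> \<le> 2 ^ 2 ^ k" by (rule elim(3))
      finally show ?thesis by simp
    qed
    then have "fact (2 * 2 ^ k) \<le> card (gates (C ?n))"
      using elim(1) sensitive_imp_fact_le_card_gates by blast
    then have "fact (2 * 2 ^ k) \<le> real (card (gates (C ?n)))"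
      by (metis of_nat_fact of_nat_le_iff)
    with elim(4) show ?case by (rule less_le_trans)
  qed
  with dim_at_top sequentially_bot show ?thesis by (rule filterlim_eventually_imp_frequently)
qed

theorem theorem1p2:
  shows "\<not> (\<exists>C :: nat \<Rightarrow> 'g circuit.
    (\<forall>n\<ge>1. xor_circuit n (C n)) \<and>
    (\<exists>p :: real poly. \<forall>n\<ge>1. real (card (gates (C n))) \<le> poly p (real (cfi_size n))) \<and>
    (\<forall>n\<ge>1. \<forall>\<pi> \<in> Aut (hypercube n). \<exists>\<sigma>. extends_to (C n) \<pi> \<sigma>) \<and>
    (\<exists>c>0. \<forall>\<^sub>F n in sequentially.
       c * real (treewidth (hypercube n)) \<le> real (card {g. sensitive_to (C n) g})) \<and>
    (\<exists>K :: real. \<forall>\<^sub>F n in sequentially. \<forall>g h. (h, g) \<in> wires (C n) \<longrightarrow>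
       real (card (orbit_fixing n (C n) h g)) \<le> K * log 2 (real (cfi_size n)) \<and>
       real (card (orbit_fixing n (C n) g h)) \<le> K * log 2 (real (cfi_size n))))"
    (is "\<not> (\<exists>C. ?circuits C \<and> (\<exists>p. ?size C p) \<and> ?symmetric C \<and>
      (\<exists>c>0. ?sensitive C c) \<and> (\<exists>K. ?orbits C K))")
proof (rule notI, elim exE conjE)
  fix C p c K
  assume circuits: "?circuits C" and size: "?size C p" and symmetric: "?symmetric C"
    and sensitive: "c > 0" "?sensitive C c" and orbits: "?orbits C K"
  have "symmetric_circuit n (C n)" if "n \<ge> 1" for n
    using circuits symmetric that by unfold_locales auto
  moreover have "\<forall>\<^sub>F n in sequentially. \<exists>s. sensitive_to (C n) s"
    using sensitive by (rule eventually_sensitive_if_treewidth_le)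
  moreover have "\<forall>\<^sub>F n in sequentially. \<forall>g h. (g, h) \<in> wires (C n) \<longrightarrow>
      real (card (orbit_fixing n (C n) g h)) \<le> K * log 2 (real (cfi_size n))"
    using orbits by eventually_elim blast
  ultimately have "\<exists>\<^sub>F n in sequentially. poly p (real (cfi_size n)) < real (card (gates (C n)))"
    by (intro symmetric_circuits_superpolynomial)
  moreover have "\<forall>\<^sub>F n in sequentially. \<not> poly p (real (cfi_size n)) < real (card (gates (C n)))"
    using eventually_ge_at_top[of 1] by eventually_elim (use size in \<open>simp add: not_less\<close>)
  ultimately show False by (simp add: frequently_def)
qed

end
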